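(* Let $q,x,y\in\mathbb{R}^d$ be unit vectors with pairwise angles $\theta_{qx},\theta_{qy},\theta_{xy}$. Let $t\ge1$ and $\mathcal{I}\subseteq\{0,\dots,t\}$. Then $$p(x,y)=\sum_{a,b\in\mathcal{I}}\mathbb{P}(d_{qx}=a\cap d_{qy}=b\mid\theta_{qx},\theta_{qy},\theta_{xy}),$$ where for all $a,b\in\{0,\dots,t\}$ $$\mathbb{P}(d_{qx}=a\cap d_{qy}=b\mid\theta_{qx},\theta_{qy},\theta_{xy})=\sum_{i=0}^a\binom ti\left[\frac{\theta_{qx}+\theta_{qy}-\theta_{xy}}{2\pi}\right]^i\binom{t-i}{b-i}\left[\frac{-\theta_{qx}+\theta_{qy}+\theta_{xy}}{2\pi}\right]^{b-i}\binom{t-b}{a-i}\left[\frac{\theta_{qx}-\theta_{qy}+\theta_{xy}}{2\pi}\right]^{a-i}\left[1-\frac{\theta_{qx}+\theta_{qy}+\theta_{xy}}{2\pi}\right]^{t-a-b+i}.$$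
   Context: Hashing. For $r,v\in\mathbb{R}^d$, $h_r(v)=0$ if $r\cdot v\le0$ and $1$ otherwise. Let $g(v)=(h_{r_1}(v),\dots,h_{r_t}(v))$ with $r_1,\dots,r_t$ independent standard Gaussian vectors in $\mathbb{R}^d$. $d_{qx}$ and $d_{qy}$ are the Hamming distances between $g(q)$ and $g(x)$, and between $g(q)$ and $g(y)$. Key quantity. $p(x,y)=\mathbb{P}(d_{qx}\in\mathcal{I}\cap d_{qy}\in\mathcal{I}\mid\theta_{qx},\theta_{qy},\theta_{xy})$, and $\theta_{uv}=\arccos(u\cdot v)$. Conventions. $\binom nk=0$ when $k<0$ or $k>n$, and $0^0=1$. *)

theory Defs
  imports "HOL-Probability.Probability"
begin

definition sign_hash :: "real ^ 'd \<Rightarrow> real ^ 'd \<Rightarrow> nat" where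
  "sign_hash r v = (if r \<bullet> v \<le> 0 then 0 else 1)"

definition hash_code :: "(nat \<Rightarrow> real ^ 'd) \<Rightarrow> real ^ 'd \<Rightarrow> nat \<Rightarrow> nat" where
  "hash_code r v = (\<lambda>j. sign_hash (r j) v)"

text \<open>Codes of length \<open>t\<close> are functions of which only the entries \<open>1, \<dots>, t\<close> matter.\<close>

definition hamming_dist :: "nat \<Rightarrow> (nat \<Rightarrow> 'a) \<Rightarrow> (nat \<Rightarrow> 'a) \<Rightarrow> nat" where
  "hamming_dist t c c' = card {j \<in> {1..t}. c j \<noteq> c' j}"

definition hash_dist :: "(nat \<Rightarrow> 'w \<Rightarrow> real ^ 'd) \<Rightarrow> nat \<Rightarrow> real ^ 'd \<Rightarrow> real ^ 'd \<Rightarrow> 'w \<Rightarrow> nat" where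
  "hash_dist r t u v \<omega> =
     hamming_dist t (hash_code (\<lambda>j. r j \<omega>) u) (hash_code (\<lambda>j. r j \<omega>) v)"

definition std_gaussian_vector :: "'w measure \<Rightarrow> ('w \<Rightarrow> real ^ 'd) \<Rightarrow> bool" where
  "std_gaussian_vector M X \<longleftrightarrow>
     distributed M lborel X (\<lambda>v. ennreal (\<Prod>i\<in>UNIV. std_normal_density (v $ i)))"

text \<open>Meant for unit vectors only: there is no normalisation.\<close>

definition vec_angle :: "real ^ 'd \<Rightarrow> real ^ 'd \<Rightarrow> real" where
  "vec_angle u v = arccos (u \<bullet> v)"

text \<open>The vectors \<open>q\<close>, \<open>x\<close>, \<open>y\<close> are deterministic, so conditioning on their pairwise angles
  amounts to fixing them; the probability is over the random vectors \<open>r j\<close>.\<close>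

definition joint_dist_prob ::
  "'w measure \<Rightarrow> (nat \<Rightarrow> 'w \<Rightarrow> real ^ 'd) \<Rightarrow> nat \<Rightarrow>
     real ^ 'd \<Rightarrow> real ^ 'd \<Rightarrow> real ^ 'd \<Rightarrow> nat \<Rightarrow> nat \<Rightarrow> real" where
  "joint_dist_prob M r t q x y a b =
     \<P>(\<omega> in M. hash_dist r t q x \<omega> = a \<and> hash_dist r t q y \<omega> = b)"

definition joint_select_prob ::
  "'w measure \<Rightarrow> (nat \<Rightarrow> 'w \<Rightarrow> real ^ 'd) \<Rightarrow> nat \<Rightarrow> nat set \<Rightarrow>
     real ^ 'd \<Rightarrow> real ^ 'd \<Rightarrow> real ^ 'd \<Rightarrow> real" where
  "joint_select_prob M r t I q x y =
     \<P>(\<omega> in M. hash_dist r t q x \<omega> \<in> I \<and> hash_dist r t q y \<omega> \<in> I)"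

text \<open>Integer arguments, so that differences such as \<open>b - i\<close> may be negative (rather than
  truncated) and the coefficient then vanishes. This also makes the value of powers with
  negative integer exponents irrelevant.\<close>

definition binom :: "int \<Rightarrow> int \<Rightarrow> real" where
  "binom n k = (if 0 \<le> k \<and> k \<le> n then real (nat n choose nat k) else 0)"

end

theory Submission
  imports Defs
begin

text \<open>For a standard Gaussian vector \<open>r\<close> and a circle \<open>c\<close> in a plane, rotation invariance makes the
  probability that \<open>r\<close> separates \<open>c \<alpha>\<close> from \<open>c \<beta>\<close> a function \<open>F\<close> of \<open>\<beta> - \<alpha>\<close>. Halfspaces are convex
  cones, so for an intermediate point \<open>r\<close> separates the ends of the arc iff it separates the ends
  of exactly one of the two subarcs; hence \<open>F\<close> is additive on \<open>[0, \<pi>]\<close>, and \<open>F \<pi> = 1\<close> gives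
  \<open>F s = s / \<pi>\<close>. Among three vectors \<open>r\<close> separates either no pair or exactly two, so the
  probabilities of the four cells (\<open>q\<close> separated from \<open>x\<close>, from \<open>y\<close>) solve a linear system in the
  three angles. By independence the two Hamming distances are the margins of a multinomial vector;
  \<open>i\<close> counts the coordinates where \<open>q\<close> differs from both \<open>x\<close> and \<open>y\<close>.\<close>

section \<open>Lebesgue measure under translations, reflections and orthogonal maps\<close>

lemma nn_integral_lborel_translation:
  fixes f :: "'a::euclidean_space \<Rightarrow> ennreal"
  assumes [measurable]: "f \<in> borel_measurable borel"
  shows "(\<integral>\<^sup>+y. f (y + a) \<partial>lborel) = (\<integral>\<^sup>+y. f y \<partial>lborel)"
proof -
  have "(\<integral>\<^sup>+y. f y \<partial>lborel) = (\<integral>\<^sup>+y. f y \<partial>distr lborel borel (\<lambda>y. a + y))"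
    using lborel_affine[of 1 a] by (simp add: density_1)
  then show ?thesis
    by (simp add: nn_integral_distr add.commute)
qed

lemma nn_integral_lborel_reflection:
  fixes f :: "'a::euclidean_space \<Rightarrow> ennreal"
  assumes [measurable]: "f \<in> borel_measurable borel"
  shows "(\<integral>\<^sup>+y. f (a - y) \<partial>lborel) = (\<integral>\<^sup>+y. f y \<partial>lborel)"
proof -
  have "(\<integral>\<^sup>+y. f y \<partial>lborel) = (\<integral>\<^sup>+y. f y \<partial>distr lborel borel (\<lambda>y. a - y))"
    using lborel_affine[of "-1" a] by (simp add: density_1)
  then show ?thesis
    by (simp add: nn_integral_distr)
qed

lemma borel_measurable_orthogonal_transformation:
  fixes f :: "'a::euclidean_space \<Rightarrow> 'a"
  assumes "orthogonal_transformation f"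
  shows "f \<in> borel_measurable borel"
  using orthogonal_transformation_linear[OF assms]
  by (intro borel_measurable_continuous_onI linear_continuous_on) (simp add: linear_linear)

text \<open>Uniqueness of Haar measure, by Fubini: translating the inner variable in
  \<open>\<integral>\<integral> 1\<^sub>A (f x) 1\<^sub>B y\<close> first by \<open>f x\<close> and then back shows that the image measure is
  proportional to \<open>lborel\<close>; the unit ball fixes the constant. The library's change of variables
  needs a well-ordered index type.\<close>

lemma lborel_distr_orthogonal:
  fixes f :: "'a::euclidean_space \<Rightarrow> 'a"
  assumes f: "orthogonal_transformation f"
  shows "distr lborel borel f = lborel"
proof (rule measure_eqI)
  fix A :: "'a set" assume "A \<in> sets (distr lborel borel f)"
  then have A [measurable]: "A \<in> sets borel" by simp
  have lin: "linear f" using f by (rule orthogonal_transformation_linear)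
  have [measurable]: "f \<in> borel_measurable borel"
    by (rule borel_measurable_orthogonal_transformation[OF f])
  define B :: "'a set" where "B = ball 0 1"
  have [measurable]: "B \<in> sets borel" by (simp add: B_def)
  have vimage: "(\<integral>\<^sup>+x. indicator C (f x) \<partial>lborel) = emeasure lborel (f -` C)"
    if [measurable]: "C \<in> sets borel" for C
    by (subst nn_integral_indicator[symmetric])
      (auto intro!: nn_integral_cong measurable_sets_borel[of f borel] simp: indicator_def)
  have "emeasure lborel (f -` A) * emeasure lborel B
      = (\<integral>\<^sup>+x. \<integral>\<^sup>+y. indicator A (f x) * indicator B y \<partial>lborel \<partial>lborel)"
    by (simp add: nn_integral_cmult nn_integral_multc vimage)
  also have "\<dots> = (\<integral>\<^sup>+x. \<integral>\<^sup>+y. indicator A (f x) * indicator B (y + f x) \<partial>lborel \<partial>lborel)"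
    by (rule nn_integral_cong, subst (2) nn_integral_cmult, simp, subst nn_integral_lborel_translation)
      (simp_all add: nn_integral_cmult)
  also have "\<dots> = (\<integral>\<^sup>+y. \<integral>\<^sup>+x. indicator A (f x) * indicator B (y + f x) \<partial>lborel \<partial>lborel)"
    by (rule lborel_pair.Fubini'[symmetric]) measurable
  also have "\<dots> = (\<integral>\<^sup>+y. \<integral>\<^sup>+x. indicator A (f x - y) * indicator B (f x) \<partial>lborel \<partial>lborel)"
  proof (rule nn_integral_cong)
    fix y :: 'a
    \<comment> \<open>By linearity, shifting \<open>f x\<close> by \<open>y\<close> is the same as
      shifting \<open>x\<close> by a preimage \<open>b\<close> of \<open>y\<close>, and
      \<open>lborel\<close> is invariant under that shift.\<close>
    obtain b where b: "y = f b" using orthogonal_transformation_surj[OF f] by (metis surjD)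
    have "(\<integral>\<^sup>+x. indicator A (f (x + b) - y) * indicator B (f (x + b)) \<partial>lborel)
        = (\<integral>\<^sup>+x. indicator A (f x - y) * indicator B (f x) \<partial>lborel)"
      by (rule nn_integral_lborel_translation[of "\<lambda>x. indicator A (f x - y) * indicator B (f x)"]) measurable
    then show "(\<integral>\<^sup>+x. indicator A (f x) * indicator B (y + f x) \<partial>lborel)
        = (\<integral>\<^sup>+x. indicator A (f x - y) * indicator B (f x) \<partial>lborel)"
      by (simp add: b linear_add[OF lin] add.commute)
  qed
  also have "\<dots> = (\<integral>\<^sup>+x. \<integral>\<^sup>+y. indicator A (f x - y) * indicator B (f x) \<partial>lborel \<partial>lborel)"
    by (rule lborel_pair.Fubini') measurable
  also have "\<dots> = emeasure lborel A * emeasure lborel (f -` B)"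
    by (simp add: nn_integral_cmult nn_integral_multc nn_integral_lborel_reflection vimage)
  also have "f -` B = B"
    by (auto simp: B_def orthogonal_transformation_norm[OF f])
  finally have "emeasure lborel (f -` A) * emeasure lborel B = emeasure lborel A * emeasure lborel B" .
  moreover have "emeasure lborel B \<noteq> 0" "emeasure lborel B \<noteq> \<infinity>"
    using content_ball_pos[of 1 "0::'a"] emeasure_bounded_finite[OF bounded_ball, of "0::'a" 1]
    by (auto simp: B_def measure_def)
  ultimately show "emeasure (distr lborel borel f) A = emeasure lborel A"
    by (simp add: emeasure_distr mult.commute[of _ "emeasure lborel B"] ennreal_mult_cancel_left)
qed simp

section \<open>Additive functions on an interval\<close>

text \<open>Additivity settles the multiples of \<open>L / n\<close>, and nonnegativity makes
  \<open>F\<close> monotone, which squeezes the remaining points. Only the lower bound needs the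
  grid: applied at \<open>L - s\<close> it yields the upper bound at \<open>s\<close>, because
  \<open>F s + F (L - s) = F L\<close>.\<close>

lemma nonneg_additive_imp_linear:
  fixes F :: "real \<Rightarrow> real"
  assumes add: "\<And>s t. 0 \<le> s \<Longrightarrow> 0 \<le> t \<Longrightarrow> s + t \<le> L \<Longrightarrow> F (s + t) = F s + F t"
    and nonneg: "\<And>s. 0 \<le> s \<Longrightarrow> s \<le> L \<Longrightarrow> 0 \<le> F s"
    and "0 < L" "0 \<le> s" "s \<le> L"
  shows "F s = s / L * F L"
proof -
  have F0: "F 0 = 0" using add[of 0 0] \<open>0 < L\<close> by simp
  have mult: "F (real k * u) = real k * F u" if "0 \<le> u" "real k * u \<le> L" for k u
    using that
  proof (induction k)
    case (Suc k)
    have "real k * u \<le> L" using Suc.prems by (simp add: algebra_simps)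
    then show ?case
      using Suc add[of "real k * u" u] by (simp add: algebra_simps)
  qed (simp add: F0)
  have lower: "s / L * F L \<le> F s" if s: "0 \<le> s" "s \<le> L" for s
  proof -
    have "s / L * F L - F L / real n \<le> F s" if n: "n > 0" for n
    proof -
      \<comment> \<open>\<open>real k * (L / real n)\<close> is the last grid point not beyond
        \<open>s\<close>, so replacing \<open>s\<close> by it loses at most
        \<open>F L / real n\<close>, which vanishes as \<open>n\<close> grows.\<close>
      define k where "k = nat \<lfloor>real n * s / L\<rfloor>"
      have k: "real k \<le> real n * s / L" "real n * s / L < real k + 1"
        using s \<open>0 < L\<close> by (auto simp: k_def)
      have ks: "real k * (L / real n) \<le> s"
        using k(1) n \<open>0 < L\<close> by (simp add: field_simps)
      have FL: "0 \<le> F L" using nonneg \<open>0 < L\<close> by simp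
      have "F L = real n * F (L / real n)"
        using mult[of "L / real n" n] n \<open>0 < L\<close> by simp
      then have Fn: "F (L / real n) = F L / real n"
        using n by (simp add: field_simps)
      have "s / L * F L - F L / real n = (real n * s / L - 1) * (F L / real n)"
        using n by (simp add: field_simps)
      also have "\<dots> \<le> real k * (F L / real n)"
        using k FL by (intro mult_right_mono) auto
      also have "\<dots> = F (real k * (L / real n))"
        using mult[of "L / real n" k] ks s \<open>0 < L\<close> Fn by simp
      also have "\<dots> \<le> F s"
        using add[of "real k * (L / real n)" "s - real k * (L / real n)"]
          nonneg[of "s - real k * (L / real n)"] ks s \<open>0 < L\<close>
        by (smt (verit) of_nat_0_le_iff divide_nonneg_nonneg mult_nonneg_nonneg)
      finally show ?thesis .
    qed
    then have "\<forall>\<^sub>F n in sequentially. s / L * F L - F L / real n \<le> F s"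
      by (intro eventually_sequentiallyI[of 1]) auto
    moreover have "(\<lambda>n. s / L * F L - F L / real n) \<longlonglongrightarrow> s / L * F L - 0"
      by (intro tendsto_diff tendsto_const lim_const_over_n)
    ultimately show ?thesis
      by (intro tendsto_upperbound[of _ "s / L * F L"]) auto
  qed
  have "F L = F s + F (L - s)" using add[of s "L - s"] assms by simp
  moreover have "(L - s) / L * F L \<le> F (L - s)" by (rule lower) (use assms in auto)
  moreover have "(L - s) / L * F L = F L - s / L * F L"
    using \<open>0 < L\<close> by (simp add: field_simps)
  ultimately show ?thesis using lower[of s] assms by simp
qed

section \<open>Gaussian vectors: rotation invariance and separation events\<close>

text \<open>Hyperplane reflections are the only orthogonal maps to be applied: a single one moves an
  arc of a circle to angle 0, up to exchanging its ends.\<close>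

lemma orthogonal_transformation_reflection:
  fixes n :: "'a::real_inner"
  assumes "norm n = 1"
  shows "orthogonal_transformation (\<lambda>v. v - (2 * (v \<bullet> n)) *\<^sub>R n)"
proof -
  have "n \<bullet> n = 1" using assms by (simp add: norm_eq_1)
  then show ?thesis
    by (auto simp: orthogonal_transformation_def linear_iff inner_diff inner_add algebra_simps inner_commute)
qed

text \<open>The density depends on \<open>v\<close> through its norm only, which is where rotation
  invariance comes from.\<close>

lemma prod_std_normal_density:
  fixes v :: "real ^ 'd"
  shows "(\<Prod>i\<in>UNIV. std_normal_density (v $ i))
    = (1 / sqrt (2 * pi)) ^ CARD('d) * exp (- (norm v)\<^sup>2 / 2)"
proof -
  have "(\<Prod>i\<in>UNIV. std_normal_density (v $ i))
      = (1 / sqrt (2 * pi)) ^ CARD('d) * exp (\<Sum>i\<in>UNIV. - (v $ i)\<^sup>2 / 2)"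
    by (simp add: std_normal_density_def prod_dividef power_divide exp_sum)
  also have "(\<Sum>i\<in>UNIV. - (v $ i)\<^sup>2 / 2) = - (norm v)\<^sup>2 / 2"
    unfolding power2_norm_eq_inner inner_vec_def
    by (simp add: power2_eq_square sum_negf flip: sum_divide_distrib)
  finally show ?thesis .
qed

lemma sign_hash_eq_iff: "sign_hash w u = sign_hash w v \<longleftrightarrow> (w \<bullet> u \<le> 0 \<longleftrightarrow> w \<bullet> v \<le> 0)"
  by (simp add: sign_hash_def)

lemma measurable_sign_hash_eq [measurable]:
  fixes X :: "'w \<Rightarrow> real ^ 'd"
  assumes [measurable]: "X \<in> borel_measurable M"
  shows "Measurable.pred M (\<lambda>\<omega>. sign_hash (X \<omega>) u = sign_hash (X \<omega>) v)"
  unfolding sign_hash_eq_iff by measurable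

locale gaussian_vector = prob_space M for M :: "'w measure" +
  fixes X :: "'w \<Rightarrow> real ^ 'd"
  assumes std_gaussian: "std_gaussian_vector M X"
begin

lemma random_variable_X [measurable]: "X \<in> borel_measurable M"
  using distributed_measurable[OF std_gaussian[unfolded std_gaussian_vector_def]] by simp

lemma distr_X: "distr M borel X = density lborel (\<lambda>v. ennreal (\<Prod>i\<in>UNIV. std_normal_density (v $ i)))"
  using distributed_distr_eq_density[OF std_gaussian[unfolded std_gaussian_vector_def]]
  by (simp cong: distr_cong)

text \<open>Both ingredients of the law are invariant under \<open>f\<close>: the density because
  \<open>f\<close> preserves norms, and the reference measure by
  \<open>lborel_distr_orthogonal\<close>.\<close>

lemma distr_orthogonal:
  assumes f: "orthogonal_transformation f"
  shows "distr M borel (\<lambda>\<omega>. f (X \<omega>)) = distr M borel X"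
proof (rule measure_eqI)
  have [measurable]: "f \<in> borel_measurable borel"
    by (rule borel_measurable_orthogonal_transformation[OF f])
  let ?p = "\<lambda>v::real^'d. ennreal (\<Prod>i\<in>UNIV. std_normal_density (v $ i))"
  have p [measurable]: "?p \<in> borel_measurable borel"
    by (simp add: prod_std_normal_density)
  have pf: "?p (f v) = ?p v" for v
    by (simp add: prod_std_normal_density orthogonal_transformation_norm[OF f])
  fix A assume "A \<in> sets (distr M borel (\<lambda>\<omega>. f (X \<omega>)))"
  then have [measurable]: "A \<in> sets borel" by simp
  have "emeasure (distr M borel (\<lambda>\<omega>. f (X \<omega>))) A = emeasure (distr M borel X) (f -` A)"
    using measurable_sets_borel[of f borel A]
    by (simp add: emeasure_distr vimage_def)
  also have "\<dots> = (\<integral>\<^sup>+v. ?p (f v) * indicator A (f v) \<partial>lborel)"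
    using measurable_sets_borel[of f borel A] pf
    by (auto simp: distr_X emeasure_density intro!: nn_integral_cong split: split_indicator)
  also have "\<dots> = (\<integral>\<^sup>+v. ?p v * indicator A v \<partial>distr lborel borel f)"
    by (subst nn_integral_distr) simp_all
  also have "\<dots> = emeasure (distr M borel X) A"
    by (simp add: lborel_distr_orthogonal[OF f] distr_X emeasure_density)
  finally show "emeasure (distr M borel (\<lambda>\<omega>. f (X \<omega>))) A = emeasure (distr M borel X) A" .
qed simp

definition differ_prob :: "real ^ 'd \<Rightarrow> real ^ 'd \<Rightarrow> real" where
  "differ_prob u v = \<P>(\<omega> in M. sign_hash (X \<omega>) u \<noteq> sign_hash (X \<omega>) v)"

text \<open>Shows that only the law of \<open>X\<close> matters, so that
  \<open>distr_orthogonal\<close> can be applied.\<close>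

lemma differ_prob_measure:
  "differ_prob u v = measure (distr M borel X) {w. sign_hash w u \<noteq> sign_hash w v}"
proof -
  have "{w. sign_hash w u \<noteq> sign_hash w v} \<in> sets borel" by measurable
  then show ?thesis
    by (auto simp: measure_distr differ_prob_def intro!: arg_cong[where f = prob])
qed

text \<open>Replacing \<open>X\<close> by \<open>f (X \<omega>)\<close> does not change its law, and
  then \<open>f\<close> cancels from every inner product.\<close>

lemma differ_prob_orthogonal:
  assumes f: "orthogonal_transformation f"
  shows "differ_prob (f u) (f v) = differ_prob u v"
proof -
  let ?D = "\<lambda>u v. {w::real^'d. sign_hash w u \<noteq> sign_hash w v}"
  have D: "?D a b \<in> sets borel" for a b by measurable
  have [measurable]: "f \<in> borel_measurable borel"
    by (rule borel_measurable_orthogonal_transformation[OF f])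
  have eq: "sign_hash (f w) (f z) = sign_hash w z" for w z
    using f by (simp add: sign_hash_def orthogonal_transformation_def)
  have "differ_prob (f u) (f v) = measure (distr M borel X) (?D (f u) (f v))"
    by (simp add: differ_prob_measure)
  also have "\<dots> = measure (distr M borel (\<lambda>\<omega>. f (X \<omega>))) (?D (f u) (f v))"
    by (simp add: distr_orthogonal[OF f])
  also have "\<dots> = differ_prob u v"
    by (subst measure_distr[OF _ D])
      (auto simp: differ_prob_def eq intro!: arg_cong[where f = prob])
  finally show ?thesis .
qed

lemma differ_prob_commute: "differ_prob u v = differ_prob v u"
  unfolding differ_prob_def by (metis (no_types))

text \<open>The hyperplane orthogonal to \<open>u\<close> is a Lebesgue null set, and the law of
  \<open>X\<close> has a density.\<close>

lemma AE_inner_nonzero: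
  assumes "u \<noteq> 0"
  shows "AE \<omega> in M. X \<omega> \<bullet> u \<noteq> 0"
proof -
  have "{v. u \<bullet> v = 0} \<in> null_sets lebesgue"
    using negligible_hyperplane[of u 0] assms by (simp add: negligible_iff_null_sets)
  then have "AE v in lborel. v \<bullet> u \<noteq> 0"
    by (auto simp: AE_completion_iff inner_commute dest!: AE_not_in)
  then have "AE v in distr M borel X. v \<bullet> u \<noteq> 0"
    unfolding distr_X prod_std_normal_density by (subst AE_density) (auto elim: eventually_mono)
  then show ?thesis by (simp add: AE_distr_iff)
qed

text \<open>Off the hyperplane orthogonal to \<open>u\<close> the two signs are opposite. On it both
  hashes are 0, so the separation is only almost sure.\<close>

lemma differ_prob_minus:
  assumes "u \<noteq> 0"
  shows "differ_prob u (- u) = 1"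
  unfolding differ_prob_def
  by (subst prob_Collect_eq_1, measurable) (use AE_inner_nonzero[OF assms] in \<open>auto simp: sign_hash_def\<close>)

text \<open>Hashes take two values: if those of \<open>u\<close> and \<open>w\<close> differ, that
  of \<open>v\<close> differs from exactly one of them. The assumption excludes that
  \<open>v\<close> differs from both, so separation of \<open>u\<close> and \<open>w\<close> is
  almost surely the disjoint union of the other two events.\<close>

lemma differ_prob_add:
  assumes "AE \<omega> in M. sign_hash (X \<omega>) u = sign_hash (X \<omega>) w \<longrightarrow> sign_hash (X \<omega>) v = sign_hash (X \<omega>) u"
  shows "differ_prob u w = differ_prob u v + differ_prob v w"
proof -
  let ?A = "\<lambda>u v. {\<omega> \<in> space M. sign_hash (X \<omega>) u \<noteq> sign_hash (X \<omega>) v}"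
  have "prob (?A u w) = prob (?A u v \<union> ?A v w)"
  proof (rule finite_measure_eq_AE)
    show "AE \<omega> in M. \<omega> \<in> ?A u w \<longleftrightarrow> \<omega> \<in> ?A u v \<union> ?A v w"
      using assms by eventually_elim (simp add: sign_hash_eq_iff, blast)
  qed measurable
  also have "\<dots> = prob (?A u v) + prob (?A v w)"
  proof (rule measure_Un_AE)
    show "AE \<omega> in M. \<omega> \<notin> ?A u v \<or> \<omega> \<notin> ?A v w"
      using assms by eventually_elim (simp add: sign_hash_eq_iff, blast)
  qed (simp_all add: fmeasurable_eq_sets)
  finally show ?thesis by (simp add: differ_prob_def)
qed

end

section \<open>The separation probability as an angle\<close>

context gaussian_vector
begin

lemma differ_prob_rotate:
  assumes e: "norm e1 = 1" "norm e2 = 1" "e1 \<bullet> e2 = 0"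
  defines "c \<equiv> \<lambda>\<phi>. cos \<phi> *\<^sub>R e1 + sin \<phi> *\<^sub>R e2"
  shows "differ_prob (c \<alpha>) (c \<beta>) = differ_prob (c 0) (c (\<beta> - \<alpha>))"
proof -
  \<comment> \<open>The reflection in the line at angle \<open>\<beta> / 2\<close> sends the angles \<open>\<alpha>\<close>, \<open>\<beta>\<close> to \<open>\<beta> - \<alpha>\<close>, \<open>0\<close>.\<close>
  define n where "n = - sin (\<beta> / 2) *\<^sub>R e1 + cos (\<beta> / 2) *\<^sub>R e2"
  have e': "e1 \<bullet> e1 = 1" "e2 \<bullet> e2 = 1" "e2 \<bullet> e1 = 0"
    using e by (simp_all add: norm_eq_1 inner_commute)
  have "n \<bullet> n = 1"
    using sin_cos_squared_add3[of "\<beta> / 2"] by (simp add: n_def inner_simps e e' add.commute)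
  then have "norm n = 1" by (simp add: norm_eq_1)
  define f where "f = (\<lambda>v. v - (2 * (v \<bullet> n)) *\<^sub>R n)"
  have orth: "orthogonal_transformation f"
    unfolding f_def by (rule orthogonal_transformation_reflection) fact
  have f: "f (c \<phi>) = c (\<beta> - \<phi>)" for \<phi>
  proof -
    have inner: "c \<phi> \<bullet> n = sin (\<phi> - \<beta> / 2)"
      by (simp add: c_def n_def inner_simps e e' sin_diff)
    have 1: "cos \<phi> + 2 * sin (\<phi> - \<beta> / 2) * sin (\<beta> / 2) = cos (\<beta> - \<phi>)"
      using sin_times_sin[of "\<phi> - \<beta> / 2" "\<beta> / 2"] by (simp add: cos_diff mult.commute)
    have 2: "sin \<phi> - 2 * sin (\<phi> - \<beta> / 2) * cos (\<beta> / 2) = sin (\<beta> - \<phi>)"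
      using sin_times_cos[of "\<phi> - \<beta> / 2" "\<beta> / 2"] sin_minus[of "\<phi> - \<beta>"] by simp
    have "f (c \<phi>) = (cos \<phi> + 2 * sin (\<phi> - \<beta> / 2) * sin (\<beta> / 2)) *\<^sub>R e1
        + (sin \<phi> - 2 * sin (\<phi> - \<beta> / 2) * cos (\<beta> / 2)) *\<^sub>R e2"
      unfolding f_def inner by (simp add: c_def n_def algebra_simps)
    then show ?thesis by (simp only: 1 2 c_def)
  qed
  have "differ_prob (c \<alpha>) (c \<beta>) = differ_prob (f (c \<alpha>)) (f (c \<beta>))"
    by (simp add: differ_prob_orthogonal[OF orth])
  then show ?thesis by (simp add: f differ_prob_commute)
qed

lemma differ_prob_circle:
  assumes e: "norm e1 = 1" "norm e2 = 1" "e1 \<bullet> e2 = 0" and "0 \<le> s" "s \<le> pi"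
  shows "differ_prob e1 (cos s *\<^sub>R e1 + sin s *\<^sub>R e2) = s / pi"
proof -
  define c where "c = (\<lambda>\<phi>. cos \<phi> *\<^sub>R e1 + sin \<phi> *\<^sub>R e2)"
  define F where "F = (\<lambda>s. differ_prob (c 0) (c s))"
  have c0: "c 0 = e1" by (simp add: c_def)
  have "e1 \<noteq> 0" using e by auto
  have diag: "differ_prob u u = 0" for u by (simp add: differ_prob_def)
  have rot: "differ_prob (c \<alpha>) (c \<beta>) = F (\<beta> - \<alpha>)" for \<alpha> \<beta>
    unfolding c_def F_def by (rule differ_prob_rotate) fact+
  have add: "F (s + t) = F s + F t" if st: "0 \<le> s" "0 \<le> t" "s + t \<le> pi" for s t
  \<comment> \<open>A degenerate subarc contributes 0; otherwise the sines of \<open>s\<close> and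
    \<open>t\<close> are strictly positive, as the cone argument requires.\<close>
  proof (cases "s = 0 \<or> t = 0")
    case False
    then have pos: "0 < sin s" "0 < sin t"
      using st by (auto intro!: sin_gt_zero)
    have "AE \<omega> in M. sign_hash (X \<omega>) (c 0) = sign_hash (X \<omega>) (c (s + t)) \<longrightarrow>
        sign_hash (X \<omega>) (c s) = sign_hash (X \<omega>) (c 0)"
      using AE_inner_nonzero[OF \<open>e1 \<noteq> 0\<close>]
    proof eventually_elim
      case (elim \<omega>)
      show ?case
      proof (cases "s + t = pi")
        case True
        \<comment> \<open>The ends are antipodal, so off the null set their hashes differ and the
          implication is vacuous.\<close>
        then have "X \<omega> \<bullet> c (s + t) = - (X \<omega> \<bullet> e1)" by (simp add: c_def)
        with elim show ?thesis by (auto simp: sign_hash_eq_iff c0)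
      next
        case False
        \<comment> \<open>Below a half-turn, \<open>c s\<close> is a combination of
          \<open>c 0\<close> and \<open>c (s + t)\<close> with positive coefficients proportional to
          \<open>sin t\<close> and \<open>sin s\<close>. Hash 0 means a closed halfspace and hash 1
          an open one; both are closed under such combinations.\<close>
        have p: "0 < sin (s + t)" by (rule sin_gt_zero) (use False st \<open>\<not> (s = 0 \<or> t = 0)\<close> in auto)
        have s1: "sin (s + t) * cos s - sin s * cos (s + t) = sin t"
          using sin_diff[of "s + t" s] by (simp add: mult.commute)
        have "sin (s + t) * (X \<omega> \<bullet> c s) = (sin (s + t) * cos s) * (X \<omega> \<bullet> e1) + sin (s + t) * sin s * (X \<omega> \<bullet> e2)"
          by (simp add: c_def inner_simps algebra_simps)
        also have "sin (s + t) * cos s = sin t + sin s * cos (s + t)"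
          using s1 by simp
        also have "(sin t + sin s * cos (s + t)) * (X \<omega> \<bullet> e1) + sin (s + t) * sin s * (X \<omega> \<bullet> e2)
            = sin t * (X \<omega> \<bullet> c 0) + sin s * (X \<omega> \<bullet> c (s + t))"
          by (simp add: c_def inner_simps algebra_simps)
        finally have eq: "sin (s + t) * (X \<omega> \<bullet> c s) = sin t * (X \<omega> \<bullet> c 0) + sin s * (X \<omega> \<bullet> c (s + t))" .
        show ?thesis
        proof (cases "X \<omega> \<bullet> c 0 \<le> 0")
          case True
          have "X \<omega> \<bullet> c s \<le> 0" if "X \<omega> \<bullet> c (s + t) \<le> 0"
          proof -
            have "sin (s + t) * (X \<omega> \<bullet> c s) \<le> 0"
              unfolding eq using that True pos by (intro add_nonpos_nonpos mult_nonneg_nonpos) auto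
            then show ?thesis using p by (simp add: mult_le_0_iff)
          qed
          with True show ?thesis by (auto simp: sign_hash_eq_iff)
        next
          case False
          have "0 < X \<omega> \<bullet> c s" if "0 < X \<omega> \<bullet> c (s + t)"
          proof -
            have "0 < sin (s + t) * (X \<omega> \<bullet> c s)"
              unfolding eq using that False pos by (intro add_pos_pos mult_pos_pos) auto
            then show ?thesis using p by (simp add: zero_less_mult_iff)
          qed
          with False show ?thesis by (auto simp: sign_hash_eq_iff not_le)
        qed
      qed
    qed
    \<comment> \<open>Rotation carries the second subarc, from \<open>s\<close> to
      \<open>s + t\<close>, to the arc from 0 to \<open>t\<close>.\<close>
    from differ_prob_add[OF this] show ?thesis
      using rot[of s "s + t"] by (simp add: F_def)
  qed (auto simp: F_def diag)
  have "F s = s / pi * F pi"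
    by (rule nonneg_additive_imp_linear[of pi F]) (use add assms in \<open>auto simp: F_def differ_prob_def\<close>)
  also have "F pi = 1"
    using differ_prob_minus[OF \<open>e1 \<noteq> 0\<close>] by (simp add: F_def c_def)
  finally show ?thesis by (simp add: F_def c0) (simp add: c_def)
qed

text \<open>Gram-Schmidt puts \<open>v\<close> on a circle through \<open>u\<close>: with
  \<open>k\<close> the cosine of the angle and \<open>w\<close> the component of \<open>v\<close>
  orthogonal to \<open>u\<close>, normalising \<open>w\<close> gives the second axis. If
  \<open>w = 0\<close> there is no such axis, and \<open>v\<close> is \<open>u\<close> or
  \<open>- u\<close>.\<close>

lemma differ_prob_eq_angle:
  assumes "norm u = 1" "norm v = 1"
  shows "differ_prob u v = vec_angle u v / pi"
proof -
  define k where "k = u \<bullet> v"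
  define w where "w = v - k *\<^sub>R u"
  have uv: "u \<bullet> u = 1" "v \<bullet> v = 1" using assms by (simp_all add: norm_eq_1)
  have k: "- 1 \<le> k" "k \<le> 1"
    using Cauchy_Schwarz_ineq2[of u v] assms by (auto simp: k_def abs_le_iff)
  have ww: "w \<bullet> w = 1 - k\<^sup>2"
    by (simp add: w_def inner_simps uv power2_eq_square inner_commute flip: k_def)
  have uw: "u \<bullet> w = 0" by (simp add: w_def inner_simps uv flip: k_def)
  show ?thesis
  proof (cases "w = 0")
    case True
    then have "k = 1 \<or> k = - 1" using ww by (simp add: power2_eq_1_iff)
    then show ?thesis
    proof
      assume "k = 1"
      with True have "v = u" by (simp add: w_def)
      then show ?thesis using uv by (simp add: vec_angle_def differ_prob_def)
    next
      assume "k = - 1"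
      with True have "v = - u" by (simp add: w_def eq_neg_iff_add_eq_0)
      moreover have "u \<noteq> 0" using assms by auto
      ultimately show ?thesis
        using uv by (simp add: vec_angle_def differ_prob_minus)
    qed
  next
    case False
    define e where "e = w /\<^sub>R norm w"
    have "norm e = 1" "u \<bullet> e = 0" using False uw by (simp_all add: e_def)
    then have "differ_prob u (cos (arccos k) *\<^sub>R u + sin (arccos k) *\<^sub>R e) = arccos k / pi"
      using assms k by (intro differ_prob_circle) (auto intro: arccos_lbound arccos_ubound)
    moreover have "sin (arccos k) = norm w"
      using k by (simp add: sin_arccos norm_eq_sqrt_inner ww)
    moreover have "k *\<^sub>R u + norm w *\<^sub>R e = v"
      using False by (simp add: e_def w_def)
    ultimately show ?thesis using k by (simp add: vec_angle_def flip: k_def)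
  qed
qed

end

section \<open>The four cells of a single hash bit\<close>

lemma (in prob_space) prob_split:
  assumes [measurable]: "Measurable.pred M P" "Measurable.pred M Q"
  shows "\<P>(\<omega> in M. P \<omega>) = \<P>(\<omega> in M. P \<omega> \<and> Q \<omega>) + \<P>(\<omega> in M. P \<omega> \<and> \<not> Q \<omega>)"
  by (subst finite_measure_Union[symmetric]) (auto intro!: arg_cong[where f = prob])

lemma (in gaussian_vector) joint_differ_prob:
  assumes "norm q = 1" "norm x = 1" "norm y = 1"
  defines "A \<equiv> \<lambda>\<omega>. sign_hash (X \<omega>) q \<noteq> sign_hash (X \<omega>) x"
    and "B \<equiv> \<lambda>\<omega>. sign_hash (X \<omega>) q \<noteq> sign_hash (X \<omega>) y"
    and "a \<equiv> vec_angle q x" and "b \<equiv> vec_angle q y" and "c \<equiv> vec_angle x y"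
  shows "\<P>(\<omega> in M. A \<omega> \<and> B \<omega>) = (a + b - c) / (2 * pi)"
    and "\<P>(\<omega> in M. A \<omega> \<and> \<not> B \<omega>) = (a - b + c) / (2 * pi)"
    and "\<P>(\<omega> in M. \<not> A \<omega> \<and> B \<omega>) = (- a + b + c) / (2 * pi)"
    and "\<P>(\<omega> in M. \<not> A \<omega> \<and> \<not> B \<omega>) = 1 - (a + b + c) / (2 * pi)"
proof -
  define C where "C = (\<lambda>\<omega>. sign_hash (X \<omega>) x \<noteq> sign_hash (X \<omega>) y)"
  have [measurable]: "Measurable.pred M A" "Measurable.pred M B" "Measurable.pred M C"
    unfolding A_def B_def C_def by measurable
  \<comment> \<open>With two possible hash values, \<open>x\<close> and \<open>y\<close> differ iff
    exactly one of them differs from \<open>q\<close>. This supplies the third equation for the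
    cells.\<close>
  have C: "C \<omega> \<longleftrightarrow> A \<omega> \<noteq> B \<omega>" for \<omega>
    by (auto simp: A_def B_def C_def sign_hash_eq_iff)
  \<comment> \<open>In units of \<open>pi\<close> the system for the cells has integer coefficients,
    and solving it is linear arithmetic.\<close>
  define a' b' c' where "a' = a / pi" "b' = b / pi" "c' = c / pi"
  have eqs: "\<P>(\<omega> in M. A \<omega>) = a'" "\<P>(\<omega> in M. B \<omega>) = b'" "\<P>(\<omega> in M. C \<omega>) = c'"
    using differ_prob_eq_angle assms(1-3)
    unfolding A_def B_def C_def a_def b_def c_def a'_b'_c'_def differ_prob_def by simp_all
  have PA: "a' = \<P>(\<omega> in M. A \<omega> \<and> B \<omega>) + \<P>(\<omega> in M. A \<omega> \<and> \<not> B \<omega>)"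
    using prob_split[of A B] eqs by simp
  have PB: "b' = \<P>(\<omega> in M. A \<omega> \<and> B \<omega>) + \<P>(\<omega> in M. \<not> A \<omega> \<and> B \<omega>)"
    using prob_split[of B A] eqs by (simp add: conj_commute)
  have "\<P>(\<omega> in M. C \<omega> \<and> A \<omega>) = \<P>(\<omega> in M. A \<omega> \<and> \<not> B \<omega>)"
    "\<P>(\<omega> in M. C \<omega> \<and> \<not> A \<omega>) = \<P>(\<omega> in M. \<not> A \<omega> \<and> B \<omega>)"
    by (auto simp: C intro!: arg_cong[where f = prob])
  then have PC: "c' = \<P>(\<omega> in M. A \<omega> \<and> \<not> B \<omega>) + \<P>(\<omega> in M. \<not> A \<omega> \<and> B \<omega>)"
    using prob_split[of C A] eqs by simp
  have "1 = \<P>(\<omega> in M. A \<omega>) + \<P>(\<omega> in M. \<not> A \<omega>)"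
    using prob_split[of "\<lambda>_. True" A] by (simp add: prob_space)
  then have P1: "1 = a' + \<P>(\<omega> in M. \<not> A \<omega> \<and> B \<omega>) + \<P>(\<omega> in M. \<not> A \<omega> \<and> \<not> B \<omega>)"
    using prob_split[of "\<lambda>\<omega>. \<not> A \<omega>" B] eqs by simp
  have halves: "(a + b - c) / (2 * pi) = (a' + b' - c') / 2" "(a - b + c) / (2 * pi) = (a' - b' + c') / 2"
    "(- a + b + c) / (2 * pi) = (- a' + b' + c') / 2" "(a + b + c) / (2 * pi) = (a' + b' + c') / 2"
    by (simp_all add: a'_b'_c'_def field_simps)
  have solve: "w11 = (a' + b' - c') / 2 \<and> w10 = (a' - b' + c') / 2
      \<and> w01 = (- a' + b' + c') / 2 \<and> w00 = 1 - (a' + b' + c') / 2"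
    if "a' = w11 + w10" "b' = w11 + w01" "c' = w10 + w01" "1 = a' + w01 + w00" for w11 w10 w01 w00
    using that by (simp add: field_simps)
  show "\<P>(\<omega> in M. A \<omega> \<and> B \<omega>) = (a + b - c) / (2 * pi)"
    "\<P>(\<omega> in M. A \<omega> \<and> \<not> B \<omega>) = (a - b + c) / (2 * pi)"
    "\<P>(\<omega> in M. \<not> A \<omega> \<and> B \<omega>) = (- a + b + c) / (2 * pi)"
    "\<P>(\<omega> in M. \<not> A \<omega> \<and> \<not> B \<omega>) = 1 - (a + b + c) / (2 * pi)"
    using solve[OF PA PB PC P1] unfolding halves by simp_all
qed

section \<open>Pairs of index sets and the multinomial count\<close>

text \<open>\<open>S\<close> is determined by the independent choices of \<open>S \<inter> T\<close>
  inside \<open>T\<close> and \<open>S - T\<close> outside it. The assumption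
  \<open>i \<le> a\<close> keeps \<open>a - i\<close> from being truncated.\<close>

lemma card_subsets_meeting:
  assumes "finite J" "T \<subseteq> J" "i \<le> a"
  shows "card {S. S \<subseteq> J \<and> card S = a \<and> card (S \<inter> T) = i}
    = (card T choose i) * ((card J - card T) choose (a - i))"
proof -
  let ?U = "{U. U \<subseteq> T \<and> card U = i}" and ?W = "{W. W \<subseteq> J - T \<and> card W = a - i}"
  have fin: "finite T" using assms finite_subset by blast
  have fin': "finite U" "finite W" if "U \<subseteq> T" "W \<subseteq> J - T" for U W
    using that fin assms(1) by (auto intro: finite_subset)
  have "bij_betw (\<lambda>(U, W). U \<union> W) (?U \<times> ?W) {S. S \<subseteq> J \<and> card S = a \<and> card (S \<inter> T) = i}"
  proof (rule bij_betw_byWitness[where f' = "\<lambda>S. (S \<inter> T, S - T)"])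
    have "card (U \<union> W) = a \<and> (U \<union> W) \<inter> T = U" if "U \<in> ?U" "W \<in> ?W" for U W
    proof -
      have "card (U \<union> W) = card U + card W"
        using that fin' by (intro card_Un_disjoint) auto
      with that assms(3) show ?thesis by auto
    qed
    moreover have "U \<union> W \<subseteq> J" if "U \<in> ?U" "W \<in> ?W" for U W
      using that assms(2) by auto
    ultimately show "(\<lambda>(U, W). U \<union> W) ` (?U \<times> ?W) \<subseteq> {S. S \<subseteq> J \<and> card S = a \<and> card (S \<inter> T) = i}"
      by (force simp del: Un_subset_iff)
    have "card (S - T) = card S - card (S \<inter> T)" if "S \<subseteq> J" for S
      using finite_subset[OF that assms(1)] by (simp add: card_Diff_subset_Int)
    then show "(\<lambda>S. (S \<inter> T, S - T)) ` {S. S \<subseteq> J \<and> card S = a \<and> card (S \<inter> T) = i} \<subseteq> ?U \<times> ?W"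
      by auto
  qed auto
  then have "card {S. S \<subseteq> J \<and> card S = a \<and> card (S \<inter> T) = i} = card (?U \<times> ?W)"
    by (rule bij_betw_same_card[symmetric])
  also have "\<dots> = (card T choose i) * (card (J - T) choose (a - i))"
    using fin assms(1) by (simp add: card_cartesian_product n_subsets)
  also have "card (J - T) = card J - card T"
    using fin assms by (simp add: card_Diff_subset)
  finally show ?thesis .
qed

text \<open>Choose \<open>T\<close> first, then group the sets \<open>S\<close> by the size
  \<open>i\<close> of their overlap with \<open>T\<close>; the inner sum is the same for every
  \<open>T\<close>.\<close>

lemma sum_subset_pairs:
  fixes g :: "nat \<Rightarrow> real"
  assumes J: "finite J"
  shows "(\<Sum>(S, T)\<in>{S. S \<subseteq> J \<and> card S = a} \<times> {T. T \<subseteq> J \<and> card T = b}. g (card (S \<inter> T)))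
    = (\<Sum>i\<le>a. real (card J choose b) * real (b choose i) * real ((card J - b) choose (a - i)) * g i)"
proof -
  let ?A = "{S. S \<subseteq> J \<and> card S = a}" and ?B = "{T. T \<subseteq> J \<and> card T = b}"
  have fin: "finite ?A" "finite ?B" using J by auto
  have inner: "(\<Sum>S\<in>?A. g (card (S \<inter> T)))
      = (\<Sum>i\<le>a. real (b choose i) * real ((card J - b) choose (a - i)) * g i)" if T: "T \<in> ?B" for T
  proof -
    have "(\<lambda>S. card (S \<inter> T)) ` ?A \<subseteq> {..a}"
      using J by (auto intro!: card_mono intro: finite_subset)
    then have "(\<Sum>S\<in>?A. g (card (S \<inter> T)))
        = (\<Sum>i\<le>a. \<Sum>S | S \<in> ?A \<and> card (S \<inter> T) = i. g (card (S \<inter> T)))"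
      using fin by (intro sum.group[symmetric]) auto
    also have "\<dots> = (\<Sum>i\<le>a. real (card {S. S \<subseteq> J \<and> card S = a \<and> card (S \<inter> T) = i}) * g i)"
      by (auto intro!: sum.cong simp: conj_assoc)
    also have "\<dots> = (\<Sum>i\<le>a. real (b choose i) * real ((card J - b) choose (a - i)) * g i)"
      using T J by (intro sum.cong) (auto simp: card_subsets_meeting)
    finally show ?thesis .
  qed
  have "(\<Sum>(S, T)\<in>?A \<times> ?B. g (card (S \<inter> T))) = (\<Sum>T\<in>?B. \<Sum>S\<in>?A. g (card (S \<inter> T)))"
    by (simp add: sum.cartesian_product[symmetric] sum.swap[of _ ?B])
  also have "\<dots> = real (card ?B) * (\<Sum>i\<le>a. real (b choose i) * real ((card J - b) choose (a - i)) * g i)"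
    using inner by simp
  finally show ?thesis
    using J by (simp add: n_subsets sum_distrib_left mult.assoc)
qed

text \<open>Let \<open>S\<close> and \<open>T\<close> be the sets of indices where \<open>P\<close>
  and \<open>Q\<close> hold. Independence makes the probability of a given pair a product over the
  four regions cut out by \<open>S\<close> and \<open>T\<close>. With the sizes \<open>a\<close> and
  \<open>b\<close> fixed, it depends on the overlap alone, so \<open>sum_subset_pairs\<close>
  applies.\<close>

lemma (in prob_space) joint_count_prob:
  fixes X :: "'i \<Rightarrow> 'a \<Rightarrow> 'b" and p11 p10 p01 p00 :: real
  assumes indep: "indep_vars (\<lambda>_. N) X J" and J: "finite J" "J \<noteq> {}"
    and [measurable]: "Measurable.pred N P" "Measurable.pred N Q"
    and p: "\<And>j. j \<in> J \<Longrightarrow> \<P>(\<omega> in M. P (X j \<omega>) \<and> Q (X j \<omega>)) = p11"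
      "\<And>j. j \<in> J \<Longrightarrow> \<P>(\<omega> in M. P (X j \<omega>) \<and> \<not> Q (X j \<omega>)) = p10"
      "\<And>j. j \<in> J \<Longrightarrow> \<P>(\<omega> in M. \<not> P (X j \<omega>) \<and> Q (X j \<omega>)) = p01"
      "\<And>j. j \<in> J \<Longrightarrow> \<P>(\<omega> in M. \<not> P (X j \<omega>) \<and> \<not> Q (X j \<omega>)) = p00"
  shows "\<P>(\<omega> in M. card {j\<in>J. P (X j \<omega>)} = a \<and> card {j\<in>J. Q (X j \<omega>)} = b)
    = (\<Sum>i\<le>a. real (card J choose b) * real (b choose i) * real ((card J - b) choose (a - i))
        * (p11 ^ i * p10 ^ (a - i) * p01 ^ (b - i) * p00 ^ (card J - b - (a - i))))"
proof -
  let ?A = "{S. S \<subseteq> J \<and> card S = a}" and ?B = "{T. T \<subseteq> J \<and> card T = b}"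
  have X [measurable]: "X j \<in> M \<rightarrow>\<^sub>M N" if "j \<in> J" for j
    using indep that by (auto simp: indep_vars_def)
  have sets: "{v \<in> space N. (P v \<longleftrightarrow> s) \<and> (Q v \<longleftrightarrow> t)} \<in> sets N" for s t
    by measurable
  \<comment> \<open>Prescribing both sets fixes the truth values of \<open>P\<close> and
    \<open>Q\<close> at each index separately, which is the product form that independence
    needs.\<close>
  have cell: "{\<omega> \<in> space M. {j\<in>J. P (X j \<omega>)} = S \<and> {j\<in>J. Q (X j \<omega>)} = T}
      = (\<Inter>j\<in>J. X j -` {v \<in> space N. (P v \<longleftrightarrow> j \<in> S) \<and> (Q v \<longleftrightarrow> j \<in> T)} \<inter> space M)"
    if "S \<subseteq> J" "T \<subseteq> J" for S T
    using that J measurable_space[OF X] by auto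
  have meas: "{\<omega> \<in> space M. {j\<in>J. P (X j \<omega>)} = S \<and> {j\<in>J. Q (X j \<omega>)} = T} \<in> sets M"
    if "S \<subseteq> J" "T \<subseteq> J" for S T
    unfolding cell[OF that] using J by (intro sets.finite_INT measurable_sets[OF X] sets) auto
  have prob_cell: "prob {\<omega> \<in> space M. {j\<in>J. P (X j \<omega>)} = S \<and> {j\<in>J. Q (X j \<omega>)} = T}
      = p11 ^ card (S \<inter> T) * p10 ^ (a - card (S \<inter> T)) * p01 ^ (b - card (S \<inter> T))
        * p00 ^ (card J - b - (a - card (S \<inter> T)))"
    if "S \<in> ?A" "T \<in> ?B" for S T
  proof -
    have ST: "S \<subseteq> J" "T \<subseteq> J" "card S = a" "card T = b" using that by auto
    have fin: "finite S" "finite T" using ST J finite_subset by auto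
    let ?p = "\<lambda>j. if j \<in> S then if j \<in> T then p11 else p10 else if j \<in> T then p01 else p00"
    have pj: "prob (X j -` {v \<in> space N. (P v \<longleftrightarrow> j \<in> S) \<and> (Q v \<longleftrightarrow> j \<in> T)} \<inter> space M) = ?p j"
      if "j \<in> J" for j
    proof -
      have "X j -` {v \<in> space N. (P v \<longleftrightarrow> j \<in> S) \<and> (Q v \<longleftrightarrow> j \<in> T)} \<inter> space M
          = {\<omega> \<in> space M. (P (X j \<omega>) \<longleftrightarrow> j \<in> S) \<and> (Q (X j \<omega>) \<longleftrightarrow> j \<in> T)}"
        using measurable_space[OF X[OF that]] by auto
      then show ?thesis using p[OF that] by simp
    qed
    have "prob {\<omega> \<in> space M. {j\<in>J. P (X j \<omega>)} = S \<and> {j\<in>J. Q (X j \<omega>)} = T} = (\<Prod>j\<in>J. ?p j)"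
      unfolding cell[OF ST(1,2)]
      by (subst indep_varsD_finite[OF indep]) (use J sets pj in auto)
    also have "\<dots> = (\<Prod>j\<in>S. if j \<in> T then p11 else p10) * (\<Prod>j\<in>J - S. if j \<in> T then p01 else p00)"
      using J ST by (subst prod.subset_diff[of S]) (auto simp: mult.commute intro!: arg_cong2[where f = "(*)"] prod.cong)
    also have "(\<Prod>j\<in>S. if j \<in> T then p11 else p10) = p11 ^ card (S \<inter> T) * p10 ^ card (S - T)"
      using fin by (simp add: prod.If_cases Diff_eq)
    also have "(\<Prod>j\<in>J - S. if j \<in> T then p01 else p00) = p01 ^ card ((J - S) \<inter> T) * p00 ^ card (J - S - T)"
      using J by (simp add: prod.If_cases Diff_eq)
    also have "card (S - T) = a - card (S \<inter> T)"
      using fin ST by (simp add: card_Diff_subset_Int)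
    also have "(J - S) \<inter> T = T - S" using ST by auto
    also have "card (T - S) = b - card (S \<inter> T)"
      using fin ST by (simp add: card_Diff_subset_Int Int_commute)
    also have "card (J - S - T) = card J - b - (a - card (S \<inter> T))"
    proof -
      \<comment> \<open>Here \<open>S - T\<close> is contained in \<open>J - T\<close>, so the
        cardinalities subtract without truncation.\<close>
      have "J - S - T = (J - T) - (S - T)" by auto
      then show ?thesis
        using J fin ST \<open>card (S - T) = a - card (S \<inter> T)\<close>
        by (simp add: card_Diff_subset Diff_mono)
    qed
    finally show ?thesis by (simp add: mult_ac)
  qed
  \<comment> \<open>The event is the disjoint union over all pairs of index sets with sizes
    \<open>a\<close> and \<open>b\<close>.\<close>
  have "\<P>(\<omega> in M. card {j\<in>J. P (X j \<omega>)} = a \<and> card {j\<in>J. Q (X j \<omega>)} = b)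
     = (\<Sum>ST\<in>?A \<times> ?B. \<P>(\<omega> in M. {j\<in>J. P (X j \<omega>)} = fst ST \<and> {j\<in>J. Q (X j \<omega>)} = snd ST))"
  proof (rule prob_sum)
    show "AE \<omega> in M. (\<forall>ST\<in>?A \<times> ?B. {j\<in>J. P (X j \<omega>)} = fst ST \<and> {j\<in>J. Q (X j \<omega>)} = snd ST \<longrightarrow>
        card {j\<in>J. P (X j \<omega>)} = a \<and> card {j\<in>J. Q (X j \<omega>)} = b) \<and>
      (card {j\<in>J. P (X j \<omega>)} = a \<and> card {j\<in>J. Q (X j \<omega>)} = b \<longrightarrow>
        (\<exists>!ST\<in>?A \<times> ?B. {j\<in>J. P (X j \<omega>)} = fst ST \<and> {j\<in>J. Q (X j \<omega>)} = snd ST))"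
    proof (intro AE_I2 conjI impI)
      fix \<omega> assume "card {j\<in>J. P (X j \<omega>)} = a \<and> card {j\<in>J. Q (X j \<omega>)} = b"
      then show "\<exists>!ST\<in>?A \<times> ?B. {j\<in>J. P (X j \<omega>)} = fst ST \<and> {j\<in>J. Q (X j \<omega>)} = snd ST"
        by (intro ex1I[of _ "({j\<in>J. P (X j \<omega>)}, {j\<in>J. Q (X j \<omega>)})"]) (auto simp: prod_eq_iff)
    qed auto
    have "{\<omega> \<in> space M. card {j\<in>J. P (X j \<omega>)} = a \<and> card {j\<in>J. Q (X j \<omega>)} = b}
       = (\<Union>(S, T)\<in>?A \<times> ?B. {\<omega> \<in> space M. {j\<in>J. P (X j \<omega>)} = S \<and> {j\<in>J. Q (X j \<omega>)} = T})"
      by auto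
    also have "\<dots> \<in> events"
      using J meas by (intro sets.finite_UN) auto
    finally show "{\<omega> \<in> space M. card {j\<in>J. P (X j \<omega>)} = a \<and> card {j\<in>J. Q (X j \<omega>)} = b} \<in> events" .
  qed (use J meas in auto)
  also have "\<dots> = (\<Sum>(S, T)\<in>?A \<times> ?B. p11 ^ card (S \<inter> T) * p10 ^ (a - card (S \<inter> T)) * p01 ^ (b - card (S \<inter> T))
        * p00 ^ (card J - b - (a - card (S \<inter> T))))"
    using prob_cell by (intro sum.cong) auto
  also note sum_subset_pairs[OF J(1)]
  finally show ?thesis .
qed

section \<open>The formula for the Hamming distances\<close>

text \<open>Choosing \<open>b\<close> elements and then \<open>i\<close> among them amounts to
  choosing the \<open>i\<close> first and then the other \<open>b - i\<close>. If
  \<open>b - i\<close> or \<open>t - a - b + i\<close> is negative, a binomial coefficient vanishes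
  on each side; otherwise every integer difference is a natural number and the powers agree,
  including exponent 0.\<close>

lemma multinomial_term_eq_binom:
  fixes p11 p10 p01 p00 :: real
  assumes "i \<le> a" "b \<le> t"
  shows "real (t choose b) * real (b choose i) * real ((t - b) choose (a - i))
      * (p11 ^ i * p10 ^ (a - i) * p01 ^ (b - i) * p00 ^ (t - b - (a - i)))
    = binom (int t) (int i) * p11 powi (int i)
      * binom (int t - int i) (int b - int i) * p01 powi (int b - int i)
      * binom (int t - int b) (int a - int i) * p10 powi (int a - int i)
      * p00 powi (int t - int a - int b + int i)"
proof (cases "i \<le> b \<and> a - i \<le> t - b")
  case True
  have b: "binom (int m) (int k) = real (m choose k)" for m k
    by (simp add: binom_def)
  have "real (t choose b) * real (b choose i) = real (t choose i) * real ((t - i) choose (b - i))"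
    using choose_mult[of i b t] True assms by (metis of_nat_mult)
  moreover have "int t - int i = int (t - i)" "int b - int i = int (b - i)"
    "int t - int b = int (t - b)" "int a - int i = int (a - i)"
    "int t - int a - int b + int i = int (t - b - (a - i))"
    using True assms by auto
  ultimately show ?thesis
    by (simp only: b power_int_of_nat mult_ac)
next
  case False
  then show ?thesis
  proof (cases "i \<le> b")
    case True
    with False assms have "(t - b) choose (a - i) = 0" "binom (int t - int b) (int a - int i) = 0"
      by (auto simp: binom_def)
    then show ?thesis by simp
  next
    case False
    then show ?thesis by (simp add: binom_def)
  qed
qed

theorem theorem6:
  fixes M :: "'w measure"
    and r :: "nat \<Rightarrow> 'w \<Rightarrow> real ^ 'd"
    and q x y :: "real ^ 'd"
    and t :: nat
    and I :: "nat set"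
    and \<theta>qx \<theta>qy \<theta>xy :: real
  assumes "prob_space M"
    and "t \<ge> 1"
    and "I \<subseteq> {0..t}"
    and "prob_space.indep_vars M (\<lambda>_. borel) r {1..t}"
    and "\<And>j. j \<in> {1..t} \<Longrightarrow> std_gaussian_vector M (r j)"
    and "norm q = 1" and "norm x = 1" and "norm y = 1"
    and "\<theta>qx = vec_angle q x" and "\<theta>qy = vec_angle q y" and "\<theta>xy = vec_angle x y"
  shows "joint_select_prob M r t I q x y = (\<Sum>a\<in>I. \<Sum>b\<in>I. joint_dist_prob M r t q x y a b) \<and>
    (\<forall>a\<in>{0..t}. \<forall>b\<in>{0..t}.
       joint_dist_prob M r t q x y a b =
         (\<Sum>i\<in>{0..a}.
            binom (int t) (int i)
              * ((\<theta>qx + \<theta>qy - \<theta>xy) / (2 * pi)) powi (int i)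
            * binom (int t - int i) (int b - int i)
              * ((- \<theta>qx + \<theta>qy + \<theta>xy) / (2 * pi)) powi (int b - int i)
            * binom (int t - int b) (int a - int i)
              * ((\<theta>qx - \<theta>qy + \<theta>xy) / (2 * pi)) powi (int a - int i)
            * (1 - (\<theta>qx + \<theta>qy + \<theta>xy) / (2 * pi)) powi (int t - int a - int b + int i)))"
proof -
  interpret prob_space M by fact
  have gv: "gaussian_vector M (r j)" if "j \<in> {1..t}" for j
    using assms(1) assms(5)[OF that] by (simp add: gaussian_vector_def gaussian_vector_axioms_def)
  have dist: "hash_dist r t u v \<omega> = card {j \<in> {1..t}. sign_hash (r j \<omega>) u \<noteq> sign_hash (r j \<omega>) v}"
    for u v \<omega>
    by (simp add: hash_dist_def hamming_dist_def hash_code_def)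
  have [measurable]: "hash_dist r t u v \<in> M \<rightarrow>\<^sub>M count_space UNIV" for u v
  proof -
    have "Measurable.pred M (\<lambda>\<omega>. j \<in> {j \<in> {1..t}. sign_hash (r j \<omega>) u \<noteq> sign_hash (r j \<omega>) v})" for j
    \<comment> \<open>A cardinality is measurable once membership of each index is. Measurability of
      \<open>r j\<close> is available only for \<open>j\<close> in \<open>{1..t}\<close>; for other
      \<open>j\<close> membership is constantly false.\<close>
    proof (cases "j \<in> {1..t}")
      case True
      then have [measurable]: "r j \<in> borel_measurable M"
        by (rule gaussian_vector.random_variable_X[OF gv])
      show ?thesis by measurable
    next
      case False
      then have "(\<lambda>\<omega>. j \<in> {j \<in> {1..t}. sign_hash (r j \<omega>) u \<noteq> sign_hash (r j \<omega>) v}) = (\<lambda>_. False)"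
        by auto
      then show ?thesis by (simp only:) measurable
    qed
    then have "(\<lambda>\<omega>. card {j \<in> {1..t}. sign_hash (r j \<omega>) u \<noteq> sign_hash (r j \<omega>) v}) \<in> M \<rightarrow>\<^sub>M count_space UNIV"
      by (intro measurable_card predE)
    moreover have "hash_dist r t u v = (\<lambda>\<omega>. card {j \<in> {1..t}. sign_hash (r j \<omega>) u \<noteq> sign_hash (r j \<omega>) v})"
      by (rule ext) (rule dist)
    ultimately show ?thesis by (simp only:)
  qed
  have "finite I" using assms(3) finite_subset by blast
  \<comment> \<open>The pairs of values in \<open>I \<times> I\<close> split the event into finitely
    many disjoint pieces.\<close>
  have "\<P>(\<omega> in M. hash_dist r t q x \<omega> \<in> I \<and> hash_dist r t q y \<omega> \<in> I)
      = (\<Sum>ab\<in>I \<times> I. \<P>(\<omega> in M. hash_dist r t q x \<omega> = fst ab \<and> hash_dist r t q y \<omega> = snd ab))"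
  proof (rule prob_sum)
    show "AE \<omega> in M. (\<forall>ab\<in>I \<times> I. hash_dist r t q x \<omega> = fst ab \<and> hash_dist r t q y \<omega> = snd ab \<longrightarrow>
        hash_dist r t q x \<omega> \<in> I \<and> hash_dist r t q y \<omega> \<in> I) \<and>
      (hash_dist r t q x \<omega> \<in> I \<and> hash_dist r t q y \<omega> \<in> I \<longrightarrow>
        (\<exists>!ab\<in>I \<times> I. hash_dist r t q x \<omega> = fst ab \<and> hash_dist r t q y \<omega> = snd ab))"
    proof (intro AE_I2 conjI impI)
      fix \<omega> assume "hash_dist r t q x \<omega> \<in> I \<and> hash_dist r t q y \<omega> \<in> I"
      then show "\<exists>!ab\<in>I \<times> I. hash_dist r t q x \<omega> = fst ab \<and> hash_dist r t q y \<omega> = snd ab"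
        by (intro ex1I[of _ "(hash_dist r t q x \<omega>, hash_dist r t q y \<omega>)"]) (auto simp: prod_eq_iff)
    qed auto
  qed (simp add: \<open>finite I\<close>, measurable)
  then have select: "joint_select_prob M r t I q x y = (\<Sum>a\<in>I. \<Sum>b\<in>I. joint_dist_prob M r t q x y a b)"
    by (simp add: joint_select_prob_def joint_dist_prob_def sum.cartesian_product case_prod_beta)
  \<comment> \<open>Here \<open>P\<close> and \<open>Q\<close> say that a hash direction separates
    \<open>q\<close> from \<open>x\<close> and from \<open>y\<close>, and \<open>t \<ge> 1\<close>
    makes the index set \<open>{1..t}\<close> nonempty. The bound \<open>b \<le> t\<close> enters
    only in the passage to \<open>binom\<close>.\<close>
  have joint: "joint_dist_prob M r t q x y a b =
      (\<Sum>i\<le>a. real (t choose b) * real (b choose i) * real ((t - b) choose (a - i))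
        * (((\<theta>qx + \<theta>qy - \<theta>xy) / (2 * pi)) ^ i * ((\<theta>qx - \<theta>qy + \<theta>xy) / (2 * pi)) ^ (a - i)
          * ((- \<theta>qx + \<theta>qy + \<theta>xy) / (2 * pi)) ^ (b - i)
          * (1 - (\<theta>qx + \<theta>qy + \<theta>xy) / (2 * pi)) ^ (t - b - (a - i))))" for a b
  proof -
    have pred: "Measurable.pred borel (\<lambda>w. sign_hash w u \<noteq> sign_hash w v)" for u v :: "real ^ 'd"
      by measurable
    show ?thesis
      unfolding joint_dist_prob_def dist assms(9-11)
      using joint_count_prob[OF assms(4) _ _ pred[of q x] pred[of q y]
          gaussian_vector.joint_differ_prob[OF gv assms(6-8)]] assms(2)
      by simp
  qed
  show ?thesis
    by (intro conjI select ballI, unfold joint atMost_atLeast0, intro sum.cong refl multinomial_term_eq_binom)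
      auto
qed

end
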